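(* The matrix $\mathbb{Q}=\mathbb{L}D\mathbb{M}\in\mathbb{R}^{N\times N}$ has the following properties: (i) $\mathrm{Ker}(\mathbb{Q})=H^1_\perp$; (ii) $\mathrm{Range}(\mathbb{Q})=H^1$; (iii) the restricted linear map $\mathbb{Q}:H^1\to H^1$ is invertible; (iv) if either (A) $D=I$, or (B) $D\neq I$ and $\mathbb{L}D\mathbb{M}=\mathbb{M}D\mathbb{L}$, then $\mathbb{Q}$ is diagonalizable and has real nonnegative eigenvalues; (v) if either (A) or (B) holds, then the zero eigenvalue of $\mathbb{Q}$ has algebraic multiplicity equal to one.
   Context: $\mathcal{G}_c$ is an undirected connected graph with node set $\{1,\dots,N\}$ and edge weights $a_{ij}=a_{ji}>0$; $\mathbb{L}=k_I\mathcal{L}(\mathcal{G}_c)$ with $k_I>0$ a constant. $\mathcal{G}_{el}$ is a weakly connected directed graph with the same node set and positive edge weights; $\mathbb{M}=\mathcal{L}(\mathcal{G}_{el})$. The Laplacian of a weighted (di)graph with incidence matrix $B$ and diagonal matrix $W$ of edge weights is $\mathcal{L}=BWB^T$ (independent of edge orientations). $D=\mathrm{diag}(d_1,\dots,d_N)$ with all $d_i>0$. $H^1=\{v\in\mathbb{R}^N: \frac1N\sum_i v_i=0\}$ and $H^1_\perp=\{\alpha\mathbf{1}_N:\alpha\in\mathbb{R}\}$ is its orthogonal complement. *)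

theory Defs
  imports
    "Graph_Theory.Graph_Theory"
    "Jordan_Normal_Form.Matrix_Kernel"
    "Jordan_Normal_Form.Char_Poly"
begin

text \<open>
  An undirected simple graph is a
  symmetric digraph (\<open>pair_graph\<close>, where both \<open>(i,j)\<close> and \<open>(j,i)\<close> are arcs), a directed simple
  graph is a \<open>pair_digraph\<close>, and \<open>connected\<close> means connectedness of the underlying
  undirected graph, i.e. weak connectedness for a digraph. Since matrices are indexed from
  \<open>0\<close>, the node set is \<open>{0..<N}\<close>.
\<close>

text \<open>
  The columns of an incidence matrix are indexed by the positions in a list of oriented
  edges. For a digraph this list enumerates the arcs; for an undirected graph it contains
  each undirected edge exactly once, in one of its two orientations.
\<close>

definition arc_list :: "nat pair_pre_digraph \<Rightarrow> (nat \<times> nat) list \<Rightarrow> bool" where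
  "arc_list G es \<longleftrightarrow> distinct es \<and> set es = parcs G"

definition orientation :: "nat pair_pre_digraph \<Rightarrow> (nat \<times> nat) list \<Rightarrow> bool" where
  "orientation G es \<longleftrightarrow>
     distinct es \<and> set es \<union> (set es)\<inverse> = parcs G \<and> set es \<inter> (set es)\<inverse> = {}"

definition incidence_mat :: "nat \<Rightarrow> (nat \<times> nat) list \<Rightarrow> real mat" where
  "incidence_mat N es =
     mat N (length es) (\<lambda>(i, k). if i = snd (es ! k) then 1
                               else if i = fst (es ! k) then -1 else 0)"

definition weight_mat :: "(nat \<times> nat) list \<Rightarrow> (nat \<Rightarrow> nat \<Rightarrow> real) \<Rightarrow> real mat" where
  "weight_mat es w = mat_diag (length es) (\<lambda>k. w (fst (es ! k)) (snd (es ! k)))"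

definition laplacian :: "nat \<Rightarrow> (nat \<times> nat) list \<Rightarrow> (nat \<Rightarrow> nat \<Rightarrow> real) \<Rightarrow> real mat" where
  "laplacian N es w =
     incidence_mat N es * weight_mat es w * transpose_mat (incidence_mat N es)"

definition H1 :: "nat \<Rightarrow> real vec set" where
  "H1 N = {v \<in> carrier_vec N. 1 / real N * (\<Sum>i<N. v $ i) = 0}"

definition H1_perp :: "nat \<Rightarrow> real vec set" where
  "H1_perp N = {\<alpha> \<cdot>\<^sub>v vec N (\<lambda>_. 1) | \<alpha>. True}"

definition mat_range :: "real mat \<Rightarrow> real vec set" where
  "mat_range A = (\<lambda>v. A *\<^sub>v v) ` carrier_vec (dim_col A)"

definition diagonalizable :: "real mat \<Rightarrow> bool" where
  "diagonalizable A \<longleftrightarrow> (\<exists>B. diagonal_mat B \<and> similar_mat A B)"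

text \<open>All complex eigenvalues of the real matrix are real and nonnegative.\<close>

definition real_nonneg_eigenvalues :: "real mat \<Rightarrow> bool" where
  "real_nonneg_eigenvalues A \<longleftrightarrow>
     (\<forall>z. eigenvalue (map_mat complex_of_real A) z \<longrightarrow> z \<in> \<real> \<and> Re z \<ge> 0)"

definition algebraic_multiplicity :: "real mat \<Rightarrow> real \<Rightarrow> nat" where
  "algebraic_multiplicity A x = order x (char_poly A)"

end

theory Submission
  imports Defs "Jordan_Normal_Form.Jordan_Normal_Form_Existence"
    "Jordan_Normal_Form.Jordan_Normal_Form_Uniqueness"
begin

text \<open>
  The quadratic form of a Laplacian is the sum of \<open>w\<^sub>i\<^sub>j (v\<^sub>j - v\<^sub>i)\<^sup>2\<close> over the edges, so for a
  connected graph it is positive semidefinite and vanishes exactly on the constants. If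
  \<open>L D M v = 0\<close>, then \<open>D M v\<close> is constant and orthogonal to \<open>M v\<close>, so \<open>D > 0\<close> forces
  \<open>M v = 0\<close>; this gives the kernel, and with it the range. For the spectrum, \<open>Q\<close> is self-adjoint
  for some inner product: the one of \<open>M\<close> plus the all-ones matrix if \<open>D = I\<close>, and the standard
  one if \<open>L D M = M D L\<close>. A self-adjoint real matrix has only real eigenvalues, hence a real
  Jordan form, whose blocks are trivial because \<open>(Q - e)\<^sup>2 v = 0\<close> implies \<open>(Q - e) v = 0\<close>; in
  particular algebraic multiplicities are dimensions of kernels.
\<close>

section \<open>Matrices self-adjoint for an inner product\<close>

text \<open>\<open>C\<close> is the Gram matrix of an inner product; that \<open>A\<close> is
  self-adjoint for it is expressed below as symmetry of \<open>C * A\<close>.\<close>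

definition pos_def_mat :: "nat \<Rightarrow> real mat \<Rightarrow> bool" where
  "pos_def_mat n C \<longleftrightarrow> C \<in> carrier_mat n n \<and> transpose_mat C = C \<and>
     (\<forall>v\<in>carrier_vec n. v \<noteq> 0\<^sub>v n \<longrightarrow> v \<bullet> (C *\<^sub>v v) > 0)"

lemma pos_def_matD:
  assumes "pos_def_mat n C"
  shows "C \<in> carrier_mat n n" "transpose_mat C = C"
    "v \<in> carrier_vec n \<Longrightarrow> v \<noteq> 0\<^sub>v n \<Longrightarrow> v \<bullet> (C *\<^sub>v v) > 0"
    "v \<in> carrier_vec n \<Longrightarrow> v \<bullet> (C *\<^sub>v v) \<ge> 0"
    "v \<in> carrier_vec n \<Longrightarrow> v \<bullet> (C *\<^sub>v v) = 0 \<Longrightarrow> v = 0\<^sub>v n"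
proof -
  show C: "C \<in> carrier_mat n n" "transpose_mat C = C"
    and pos: "v \<in> carrier_vec n \<Longrightarrow> v \<noteq> 0\<^sub>v n \<Longrightarrow> v \<bullet> (C *\<^sub>v v) > 0" for v
    using assms by (auto simp: pos_def_mat_def)
  show "v \<in> carrier_vec n \<Longrightarrow> v \<bullet> (C *\<^sub>v v) = 0 \<Longrightarrow> v = 0\<^sub>v n"
    using pos[of v] by fastforce
  show "v \<in> carrier_vec n \<Longrightarrow> v \<bullet> (C *\<^sub>v v) \<ge> 0"
    using pos[of v] C by (cases "v = 0\<^sub>v n") (auto simp: less_imp_le)
qed

lemma sym_form_commute:
  fixes C :: "real mat"
  assumes "C \<in> carrier_mat n n" "transpose_mat C = C" "x \<in> carrier_vec n" "y \<in> carrier_vec n"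
  shows "x \<bullet> (C *\<^sub>v y) = y \<bullet> (C *\<^sub>v x)"
  using transpose_vec_mult_scalar[OF assms(1,4,3)] assms
  by (simp add: comm_scalar_prod[of "C *\<^sub>v x" n y])

lemma scalar_transpose_mult:
  fixes A B :: "'a :: comm_semiring_0 mat"
  assumes A: "A \<in> carrier_mat m n" and B: "B \<in> carrier_mat m k"
    and x: "x \<in> carrier_vec n" and y: "y \<in> carrier_vec k"
  shows "x \<bullet> ((transpose_mat A * B) *\<^sub>v y) = (A *\<^sub>v x) \<bullet> (B *\<^sub>v y)"
proof -
  have At: "transpose_mat A \<in> carrier_mat n m" using A by simp
  have By: "B *\<^sub>v y \<in> carrier_vec m" using B y by simp
  show ?thesis
    using transpose_vec_mult_scalar[OF At By x] assoc_mult_mat_vec[OF At B y] by simp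
qed

lemma pos_def_mat_one: "pos_def_mat n (1\<^sub>m n)"
  unfolding pos_def_mat_def
proof (intro conjI ballI impI)
  fix v :: "real vec" assume v: "v \<in> carrier_vec n" "v \<noteq> 0\<^sub>v n"
  then obtain i where i: "i < n" "v $ i \<noteq> 0" by (metis carrier_vecD eq_vecI index_zero_vec)
  have "v \<bullet> v > 0" unfolding scalar_prod_def
    by (rule sum_pos2[of _ i]) (use i v in \<open>auto simp: zero_less_mult_iff linorder_neq_iff\<close>)
  then show "v \<bullet> (1\<^sub>m n *\<^sub>v v) > 0" using v by simp
qed auto

text \<open>Split an eigenvector into real and imaginary parts \<open>x\<close> and
  \<open>y\<close>. Symmetry of \<open>C * A\<close> makes \<open>Im z\<close> times the sum of the
  squared \<open>C\<close>-norms of \<open>x\<close> and \<open>y\<close> vanish, so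
  \<open>Im z = 0\<close>, and whichever of \<open>x\<close>, \<open>y\<close> is nonzero is a real
  eigenvector.\<close>

lemma selfadjoint_eigenvalue_real:
  fixes A C :: "real mat"
  assumes C: "pos_def_mat n C" and A: "A \<in> carrier_mat n n"
    and sym: "transpose_mat (C * A) = C * A"
    and z: "eigenvalue (map_mat complex_of_real A) z"
  shows "z \<in> \<real> \<and> eigenvalue A (Re z)"
proof -
  note Cc = pos_def_matD(1)[OF C]
  from z A obtain u where u: "u \<in> carrier_vec n" "u \<noteq> 0\<^sub>v n"
      "map_mat complex_of_real A *\<^sub>v u = z \<cdot>\<^sub>v u"
    unfolding eigenvalue_def eigenvector_def by auto
  define x y where "x = map_vec Re u" and "y = map_vec Im u"
  have xy: "x \<in> carrier_vec n" "y \<in> carrier_vec n" using u by (auto simp: x_def y_def)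
  have ent: "(\<Sum>j = 0..<n. complex_of_real (A $$ (i, j)) * u $ j) = z * u $ i" if "i < n" for i
    using arg_cong[OF u(3), of "\<lambda>v. v $ i"] that A u(1) by (simp add: scalar_prod_def)
  have Ax: "A *\<^sub>v x = Re z \<cdot>\<^sub>v x - Im z \<cdot>\<^sub>v y"
  proof (rule eq_vecI)
    fix i assume "i < dim_vec (Re z \<cdot>\<^sub>v x - Im z \<cdot>\<^sub>v y)"
    then have i: "i < n" using u(1) by (simp add: x_def y_def)
    show "(A *\<^sub>v x) $ i = (Re z \<cdot>\<^sub>v x - Im z \<cdot>\<^sub>v y) $ i"
      using arg_cong[OF ent[OF i], of Re] i A u(1) by (simp add: scalar_prod_def x_def y_def)
  qed (use A u(1) in \<open>auto simp: y_def\<close>)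
  have Ay: "A *\<^sub>v y = Im z \<cdot>\<^sub>v x + Re z \<cdot>\<^sub>v y"
  proof (rule eq_vecI)
    fix i assume "i < dim_vec (Im z \<cdot>\<^sub>v x + Re z \<cdot>\<^sub>v y)"
    then have i: "i < n" using u(1) by (simp add: x_def y_def)
    show "(A *\<^sub>v y) $ i = (Im z \<cdot>\<^sub>v x + Re z \<cdot>\<^sub>v y) $ i"
      using arg_cong[OF ent[OF i], of Im] i A u(1) by (simp add: scalar_prod_def x_def y_def)
  qed (use A u(1) in \<open>auto simp: y_def\<close>)
  have ne: "x \<noteq> 0\<^sub>v n \<or> y \<noteq> 0\<^sub>v n"
  proof (rule ccontr)
    assume "\<not> ?thesis"
    then have "x $ i = 0 \<and> y $ i = 0" if "i < n" for i
      using that by simp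
    then have "u $ i = 0" if "i < n" for i
      using that u(1) by (auto simp: x_def y_def complex_eq_iff)
    with u show False by auto
  qed
  have "x \<bullet> ((C * A) *\<^sub>v y) = y \<bullet> ((C * A) *\<^sub>v x)"
    by (rule sym_form_commute[OF _ sym xy]) (use Cc A in auto)
  then have "x \<bullet> (C *\<^sub>v (A *\<^sub>v y)) = y \<bullet> (C *\<^sub>v (A *\<^sub>v x))" using Cc A xy by simp
  then have "Im z * (x \<bullet> (C *\<^sub>v x)) + Re z * (x \<bullet> (C *\<^sub>v y))
     = Re z * (y \<bullet> (C *\<^sub>v x)) - Im z * (y \<bullet> (C *\<^sub>v y))"
    unfolding Ax Ay using Cc xy
    by (simp add: mult_add_distrib_mat_vec[OF Cc] mult_minus_distrib_mat_vec[OF Cc] mult_mat_vec[OF Cc]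
        scalar_prod_add_distrib[of _ n] scalar_prod_minus_distrib[of _ n])
  moreover have "x \<bullet> (C *\<^sub>v y) = y \<bullet> (C *\<^sub>v x)"
    by (rule sym_form_commute[OF Cc pos_def_matD(2)[OF C] xy])
  ultimately have "Im z * (x \<bullet> (C *\<^sub>v x) + y \<bullet> (C *\<^sub>v y)) = 0" by (simp add: algebra_simps)
  moreover have "x \<bullet> (C *\<^sub>v x) + y \<bullet> (C *\<^sub>v y) > 0"
    using ne pos_def_matD(3,4)[OF C xy(1)] pos_def_matD(3,4)[OF C xy(2)]
    by (metis add_nonneg_pos add_pos_nonneg)
  ultimately have Im: "Im z = 0" by simp
  have "A *\<^sub>v x = Re z \<cdot>\<^sub>v x" "A *\<^sub>v y = Re z \<cdot>\<^sub>v y"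
    unfolding Ax Ay Im using xy by auto
  then have "eigenvector A x (Re z) \<or> eigenvector A y (Re z)"
    using ne xy A unfolding eigenvector_def by auto
  then show ?thesis using Im by (auto simp: eigenvalue_def complex_is_Real_iff)
qed

text \<open>All complex roots are eigenvalues, hence real, and the complex factorization descends
  because the embedding of polynomials is injective. Existence of a real Jordan form rests on this
  splitting.\<close>

lemma selfadjoint_char_poly_splits:
  fixes A C :: "real mat"
  assumes C: "pos_def_mat n C" and A: "A \<in> carrier_mat n n"
    and sym: "transpose_mat (C * A) = C * A"
  shows "\<exists>as. char_poly A = (\<Prod>a\<leftarrow>as. [:- a, 1:])"
proof -
  let ?A = "map_mat complex_of_real A"
  have A': "?A \<in> carrier_mat n n" using A by simp
  obtain zs where zs: "char_poly ?A = (\<Prod>z\<leftarrow>zs. [:- z, 1:])"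
    using char_poly_factorized[OF A'] by blast
  have real: "z = complex_of_real (Re z)" if "z \<in> set zs" for z
  proof -
    have "poly (char_poly ?A) z = 0" unfolding zs using that by (auto simp: poly_prod_list prod_list_zero_iff)
    then have "z \<in> \<real>"
      using selfadjoint_eigenvalue_real[OF C A sym] eigenvalue_root_char_poly[OF A'] by blast
    then show ?thesis by (simp add: complex_is_Real_iff complex_eq_iff)
  qed
  interpret h: map_poly_inj_comm_ring_hom complex_of_real ..
  have "char_poly ?A = map_poly complex_of_real (char_poly A)"
    by (rule of_real_hom.char_poly_hom[OF A])
  then have "map_poly complex_of_real (char_poly A) = (\<Prod>z\<leftarrow>zs. [:- z, 1:])"
    using zs by simp
  also have "\<dots> = map_poly complex_of_real (\<Prod>a\<leftarrow>map Re zs. [:- a, 1:])"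
    using real by (induction zs) (auto simp: hom_distribs)
  finally have "char_poly A = (\<Prod>a\<leftarrow>map Re zs. [:- a, 1:])" by (simp only: h.eq_iff)
  then show ?thesis by (rule exI)
qed

section \<open>Diagonalizability through the Jordan form\<close>

lemma transpose_mat_smult: "transpose_mat (k \<cdot>\<^sub>m A) = k \<cdot>\<^sub>m transpose_mat A"
  by (intro eq_matI) auto

lemma mult_mat_zero_vec:
  "A \<in> carrier_mat m n \<Longrightarrow> A *\<^sub>v 0\<^sub>v n = (0\<^sub>v m :: 'a :: semiring_0 vec)"
  by (intro eq_vecI) auto

text \<open>The kernel of the \<open>k\<close>-th power of \<open>A - e\<close> has dimension the
  sum of \<open>min k m\<close> over the sizes \<open>m\<close> of the Jordan blocks for
  \<open>e\<close>. Equality for exponents 1 and 2 must hold termwise, which excludes blocks of size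
  two or more.\<close>

lemma sum_list_min_eq_imp_le_1:
  assumes "(\<Sum>n\<leftarrow>ns. min 2 n) = (\<Sum>n\<leftarrow>ns. min 1 n)" "k \<in> set ns"
  shows "k \<le> (1 :: nat)"
  using assms
proof (induction ns)
  case (Cons m ns)
  have "(\<Sum>n\<leftarrow>ns. min 1 n) \<le> (\<Sum>n\<leftarrow>ns. min 2 n)" by (rule sum_list_mono) simp
  moreover have "min 1 m \<le> min 2 m" by simp
  ultimately have "(\<Sum>n\<leftarrow>ns. min 2 n) = (\<Sum>n\<leftarrow>ns. min 1 n)" "min 2 m = min 1 m"
    using Cons.prems(1) by simp_all
  then show ?case using Cons by auto
qed simp

lemma diagonal_jordan_matrix:
  "\<forall>(k, e)\<in>set n_as. k = 1 \<Longrightarrow> diagonal_mat (jordan_matrix n_as)"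
proof (induction n_as)
  case (Cons ke n_as)
  then obtain e where e: "ke = (1, e)" by (cases ke) auto
  have "diagonal_mat (jordan_matrix n_as)" using Cons by auto
  then show ?case unfolding e jordan_matrix_Cons diagonal_mat_def
    by (auto simp: jordan_matrix_def[symmetric])
qed (auto simp: diagonal_mat_def jordan_matrix_def)

lemma selfadjoint_jordan_nf:
  fixes A C :: "real mat"
  assumes C: "pos_def_mat n C" and A: "A \<in> carrier_mat n n"
    and sym: "transpose_mat (C * A) = C * A"
  obtains n_as where "jordan_nf A n_as" "\<forall>(k, e)\<in>set n_as. k = 1"
proof -
  note Cc = pos_def_matD(1)[OF C]
  obtain n_as where nf: "jordan_nf A n_as"
    using selfadjoint_char_poly_splits[OF C A sym] jordan_nf_exists[OF A] by blast
  have "k = 1" if ke: "(k, e) \<in> set n_as" for k e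
  proof -
    define E where "E = char_matrix A e"
    have E: "E \<in> carrier_mat n n" using A by (simp add: E_def)
    \<comment> \<open>Subtracting a multiple of the identity changes \<open>C * A\<close> by a
      multiple of the symmetric \<open>C\<close>, so \<open>E\<close> stays self-adjoint.\<close>
    have CE: "C * E = C * A + (-e) \<cdot>\<^sub>m C"
      unfolding E_def char_matrix_def using A Cc
      by (subst mult_add_distrib_mat[OF Cc A]) (auto simp: mult_smult_distrib[OF Cc])
    have symE: "transpose_mat (C * E) = C * E"
      unfolding CE using A Cc sym pos_def_matD(2)[OF C]
      by (subst transpose_add[of _ n n]) (auto simp: transpose_mat_smult)
    have "mat_kernel (E * E) \<subseteq> mat_kernel E"
    proof
      fix v assume "v \<in> mat_kernel (E * E)"
      then have v: "v \<in> carrier_vec n" "E *\<^sub>v (E *\<^sub>v v) = 0\<^sub>v n"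
        using E by (auto simp: mat_kernel_def)
      \<comment> \<open>The left side is the squared \<open>C\<close>-norm of \<open>E v\<close>;
        the right side contains \<open>E (E v) = 0\<close>.\<close>
      have "(E *\<^sub>v v) \<bullet> ((C * E) *\<^sub>v v) = v \<bullet> ((C * E) *\<^sub>v (E *\<^sub>v v))"
        by (rule sym_form_commute[OF _ symE]) (use Cc E v in auto)
      then have "(E *\<^sub>v v) \<bullet> (C *\<^sub>v (E *\<^sub>v v)) = 0"
        using Cc E v by (simp add: mult_mat_zero_vec[of C n n])
      then have "E *\<^sub>v v = 0\<^sub>v n" using pos_def_matD(5)[OF C] E v by auto
      then show "v \<in> mat_kernel E" using E v by (auto simp: mat_kernel_def)
    qed
    then have "mat_kernel (E ^\<^sub>m 2) = mat_kernel (E ^\<^sub>m 1)"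
      using mat_kernel_mult_subset[OF E E] E by (auto simp: numeral_2_eq_2)
    then have "dim_gen_eigenspace A e 2 = dim_gen_eigenspace A e 1"
      using E unfolding dim_gen_eigenspace_def E_def[symmetric] kernel_dim_def by simp
    then have "k \<le> 1" unfolding dim_gen_eigenspace[OF nf]
      by (rule sum_list_min_eq_imp_le_1) (use ke in force)
    moreover have "k \<noteq> 0" using nf ke by (force simp: jordan_nf_def)
    ultimately show ?thesis by simp
  qed
  with nf show ?thesis using that by blast
qed

lemma selfadjoint_diagonalizable:
  fixes A C :: "real mat"
  assumes "pos_def_mat n C" "A \<in> carrier_mat n n" "transpose_mat (C * A) = C * A"
  shows "diagonalizable A"
proof -
  obtain n_as where "jordan_nf A n_as" "\<forall>(k, e)\<in>set n_as. k = 1"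
    using selfadjoint_jordan_nf[OF assms] .
  then show ?thesis
    using diagonal_jordan_matrix by (auto simp: diagonalizable_def jordan_nf_def)
qed

text \<open>With blocks of size one only, both sides count the blocks for \<open>e\<close>.\<close>

lemma selfadjoint_order_char_poly:
  fixes A C :: "real mat"
  assumes "pos_def_mat n C" "A \<in> carrier_mat n n" "transpose_mat (C * A) = C * A"
  shows "order e (char_poly A) = kernel_dim (char_matrix A e)"
proof -
  obtain n_as where nf: "jordan_nf A n_as" and 1: "\<forall>(k, e)\<in>set n_as. k = 1"
    using selfadjoint_jordan_nf[OF assms] .
  have "order e (char_poly A) = sum_list (map fst (filter (\<lambda>na. snd na = e) n_as))"
    by (rule jordan_nf_order[OF nf])
  also have "\<dots> = (\<Sum>n\<leftarrow>map fst [(n, e')\<leftarrow>n_as. e' = e]. min 1 n)"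
    using 1 by (induction n_as) auto
  also have "\<dots> = dim_gen_eigenspace A e 1" by (rule dim_gen_eigenspace[OF nf, symmetric])
  also have "\<dots> = kernel_dim (char_matrix A e)"
    using assms(2) by (simp add: dim_gen_eigenspace_def)
  finally show ?thesis .
qed

lemma kernel_dim_line:
  fixes A :: "'a :: field mat"
  assumes A: "A \<in> carrier_mat m n" and v: "v \<noteq> 0\<^sub>v n"
    and ker: "mat_kernel A = {c \<cdot>\<^sub>v v | c. True}"
  shows "kernel_dim A = 1"
proof -
  interpret kernel m n A by unfold_locales (rule A)
  have "1 \<cdot>\<^sub>v v \<in> mat_kernel A" unfolding ker by blast
  then have vK: "v \<in> mat_kernel A" by simp
  have "span {v} = mat_kernel A"
  proof
    show "span {v} \<subseteq> mat_kernel A" using Ker.span_is_subset2[of "{v}"] vK by auto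
    show "mat_kernel A \<subseteq> span {v}"
    proof
      fix u assume "u \<in> mat_kernel A"
      then obtain c where u: "u = c \<cdot>\<^sub>v v" unfolding ker by auto
      have "v \<in> span {v}" using Ker.in_own_span[of "{v}"] vK by auto
      then show "u \<in> span {v}" unfolding u
        using Ker.span_is_submodule[of "{v}"] vK by (auto simp: submodule_def)
    qed
  qed
  then show ?thesis using Ker.dim1I[of v] v vK by simp
qed

text \<open>In a basis of eigenvectors the Gram matrix \<open>G\<close> of the inner product commutes with the diagonal
  matrix \<open>B\<close> of eigenvalues, so \<open>G B = B\<^sup>1\<^sup>/\<^sup>2 G B\<^sup>1\<^sup>/\<^sup>2\<close>.\<close>

lemma selfadjoint_form_nonneg:
  fixes A C :: "real mat"
  assumes C: "pos_def_mat n C" and A: "A \<in> carrier_mat n n"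
    and sym: "transpose_mat (C * A) = C * A"
    and ev: "\<And>e. eigenvalue A e \<Longrightarrow> e \<ge> 0"
    and x: "x \<in> carrier_vec n"
  shows "x \<bullet> (C *\<^sub>v (A *\<^sub>v x)) \<ge> 0"
proof -
  note Cc = pos_def_matD(1)[OF C] and Ct = pos_def_matD(2)[OF C]
  obtain B P R where diag: "diagonal_mat B" and wit: "similar_mat_wit A B P R"
    using selfadjoint_diagonalizable[OF C A sym] unfolding diagonalizable_def similar_mat_def by blast
  note w = similar_mat_witD2[OF A wit]
  note B = w(5) and P = w(6) and R = w(7)
  \<comment> \<open>Each diagonal entry of \<open>B\<close> is a root of the characteristic
    polynomial of \<open>A\<close>, hence an eigenvalue.\<close>
  have b: "B $$ (i, i) \<ge> 0" if i: "i < n" for i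
  proof -
    have "char_poly A = (\<Prod>a\<leftarrow>diag_mat B. [:- a, 1:])"
    proof -
      have "similar_mat A B" using wit by (auto simp: similar_mat_def)
      moreover have "upper_triangular B" using diag B by (auto simp: diagonal_mat_def)
      ultimately show ?thesis using char_poly_similar char_poly_upper_triangular[OF B] by metis
    qed
    moreover have "B $$ (i, i) \<in> set (diag_mat B)" using i B by (auto simp: diag_mat_def)
    ultimately have "poly (char_poly A) (B $$ (i, i)) = 0"
      by (auto simp: poly_prod_list prod_list_zero_iff)
    then show ?thesis using ev eigenvalue_root_char_poly[OF A] by blast
  qed
  define G where "G = transpose_mat P * (C * P)"
  have G: "G \<in> carrier_mat n n" using P Cc by (simp add: G_def)
  have Gt: "transpose_mat G = G" unfolding G_def using P Cc Ct
    by (simp add: transpose_mult[of _ n n _ n])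
  have AP: "A * P = P * B"
  proof -
    have "A * P = P * B * (R * P)" unfolding w(3)
      by (rule assoc_mult_mat[of _ n n _ n _ n]) (use B P R in auto)
    then show ?thesis unfolding w(2) using B P by simp
  qed
  \<comment> \<open>This is the symmetric form \<open>C * A\<close> written in the eigenbasis, so
    \<open>G * B\<close> is symmetric and \<open>G\<close> commutes with \<open>B\<close>.\<close>
  have GB: "G * B = transpose_mat P * ((C * A) * P)"
  proof -
    have "G * B = transpose_mat P * (C * P * B)" unfolding G_def
      by (rule assoc_mult_mat[of _ n n _ n _ n]) (use P Cc B in auto)
    also have "C * P * B = C * A * P" using Cc A P B by (simp add: AP)
    finally show ?thesis .
  qed
  have "transpose_mat (G * B) = G * B"
  proof -
    have "transpose_mat (transpose_mat P * ((C * A) * P))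
        = transpose_mat ((C * A) * P) * P"
      using P Cc A by (subst transpose_mult[of _ n n _ n]) auto
    also have "transpose_mat ((C * A) * P) = transpose_mat P * (C * A)"
      using P Cc A sym by (subst transpose_mult[of _ n n _ n]) auto
    finally have "transpose_mat (G * B) = transpose_mat P * (C * A) * P" unfolding GB .
    also have "\<dots> = G * B" unfolding GB
      by (rule assoc_mult_mat[of _ n n _ n _ n]) (use P Cc A in auto)
    finally show ?thesis .
  qed
  moreover have "transpose_mat (G * B) = B * G"
  proof -
    have "transpose_mat B = B" using diag B by (intro eq_matI) (auto simp: diagonal_mat_def, metis)
    then show ?thesis using transpose_mult[OF G B] Gt by simp
  qed
  ultimately have BG: "B * G = G * B" by simp
  define b where "b i = B $$ (i, i)" for i
  have Bb: "B = mat_diag n b"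
    using diag B by (intro eq_matI) (auto simp: diagonal_mat_def mat_diag_def b_def)
  have comm: "b i * G $$ (i, j) = G $$ (i, j) * b j" if "i < n" "j < n" for i j
    using arg_cong[OF BG, of "\<lambda>M. M $$ (i, j)"] that
    unfolding Bb mat_diag_mult_left[OF G] mat_diag_mult_right[OF G] by simp
  define S where "S = mat_diag n (\<lambda>i. sqrt (b i))"
  have S: "S \<in> carrier_mat n n" by (simp add: S_def)
  have St: "transpose_mat S = S" by (intro eq_matI) (auto simp: S_def mat_diag_def)
  have GB_S: "G * B = S * (G * S)"
  proof (rule eq_matI)
    fix i j assume "i < dim_row (S * (G * S))" "j < dim_col (S * (G * S))"
    then have ij: "i < n" "j < n" using S by auto
    have "(S * (G * S)) $$ (i, j) = sqrt (b i) * (G $$ (i, j) * sqrt (b j))"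
    proof -
      have GS: "mat n n (\<lambda>(i, j). G $$ (i, j) * sqrt (b j)) \<in> carrier_mat n n" by simp
      show ?thesis unfolding S_def mat_diag_mult_right[OF G] mat_diag_mult_left[OF GS]
        using ij by simp
    qed
    also have "\<dots> = G $$ (i, j) * b j"
    proof (cases "G $$ (i, j) = 0")
      case False
      \<comment> \<open>A nonzero entry of \<open>G\<close> only joins equal eigenvalues, and there
        the two square roots multiply to \<open>b j\<close>.\<close>
      then have "b i = b j" using comm[OF ij] by simp
      then show ?thesis using b[OF ij(2)] by (simp add: b_def[symmetric])
    qed simp
    also have "\<dots> = (G * B) $$ (i, j)" unfolding Bb mat_diag_mult_right[OF G] using ij by simp
    finally show "(G * B) $$ (i, j) = (S * (G * S)) $$ (i, j)" ..
  qed (use G B S in auto)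
  \<comment> \<open>The coordinates of \<open>x\<close> in the eigenbasis. Moving one factor
    \<open>S\<close> to each side turns the form at \<open>x\<close> into the squared
    \<open>C\<close>-norm of \<open>P S y\<close>.\<close>
  define y where "y = R *\<^sub>v x"
  have y: "y \<in> carrier_vec n" using R x by (simp add: y_def)
  have Py: "P *\<^sub>v y = x"
    unfolding y_def using assoc_mult_mat_vec[OF P R x] w(1) x by simp
  have Sy: "S *\<^sub>v y \<in> carrier_vec n" using S y by simp
  have CAP: "C * A * P \<in> carrier_mat n n" and CA: "C * A \<in> carrier_mat n n"
    and CP: "C * P \<in> carrier_mat n n" and GS: "G * S \<in> carrier_mat n n"
    using Cc A P G S by auto
  have "x \<bullet> (C *\<^sub>v (A *\<^sub>v x)) = (P *\<^sub>v y) \<bullet> ((C * A * P) *\<^sub>v y)"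
    unfolding assoc_mult_mat_vec[OF CA P y] Py assoc_mult_mat_vec[OF Cc A x] ..
  also have "\<dots> = y \<bullet> ((G * B) *\<^sub>v y)"
    unfolding GB by (rule scalar_transpose_mult[OF P CAP y y, symmetric])
  also have "\<dots> = (S *\<^sub>v y) \<bullet> ((G * S) *\<^sub>v y)"
    using scalar_transpose_mult[OF S GS y y] unfolding GB_S St .
  also have "\<dots> = (S *\<^sub>v y) \<bullet> (G *\<^sub>v (S *\<^sub>v y))"
    unfolding assoc_mult_mat_vec[OF G S y] ..
  also have "\<dots> = (P *\<^sub>v (S *\<^sub>v y)) \<bullet> ((C * P) *\<^sub>v (S *\<^sub>v y))"
    unfolding G_def by (rule scalar_transpose_mult[OF P CP Sy Sy])
  also have "\<dots> = (P *\<^sub>v (S *\<^sub>v y)) \<bullet> (C *\<^sub>v (P *\<^sub>v (S *\<^sub>v y)))"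
    unfolding assoc_mult_mat_vec[OF Cc P Sy] ..
  also have "\<dots> \<ge> 0" by (rule pos_def_matD(4)[OF C]) (use P Sy in auto)
  finally show ?thesis .
qed

lemma injective_mat_inverse:
  fixes A :: "'a :: field mat"
  assumes A: "A \<in> carrier_mat n n"
    and inj: "\<And>v. v \<in> carrier_vec n \<Longrightarrow> A *\<^sub>v v = 0\<^sub>v n \<Longrightarrow> v = 0\<^sub>v n"
  obtains B where "B \<in> carrier_mat n n" "A * B = 1\<^sub>m n" "B * A = 1\<^sub>m n"
proof -
  have "det A \<noteq> 0" using inj det_0_iff_vec_prod_zero[OF A] by blast
  \<comment> \<open>\<open>undefined\<close> only fills the extension slot of the matrix ring
    record, on which units do not depend.\<close>
  from det_non_zero_imp_unit[OF A this, of undefined] show ?thesis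
    using that by (auto simp: Units_def ring_mat_simps)
qed

lemma mat_diag_mult_vec:
  fixes v :: "real vec"
  assumes "v \<in> carrier_vec n" "i < n"
  shows "(mat_diag n d *\<^sub>v v) $ i = d i * v $ i"
proof -
  have "(mat_diag n d *\<^sub>v v) $ i = (\<Sum>j = 0..<n. (if i = j then d j else 0) * v $ j)"
    using assms unfolding mat_diag_def by (simp add: scalar_prod_def)
  also have "\<dots> = (\<Sum>j = 0..<n. if j = i then d i * v $ j else 0)"
    by (intro sum.cong) auto
  finally show ?thesis using assms by simp
qed

section \<open>Laplacians\<close>

abbreviation ones :: "nat \<Rightarrow> real vec" where
  "ones n \<equiv> vec n (\<lambda>_. 1)"

text \<open>It vanishes on \<open>H1 n\<close> and multiplies constants by \<open>n\<close>. Added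
  to a matrix with kernel \<open>H1_perp n\<close> and range inside \<open>H1 n\<close>, it yields
  an injective matrix with the same action on \<open>H1 n\<close>.\<close>

definition ones_mat :: "nat \<Rightarrow> real mat" where
  "ones_mat n = mat n n (\<lambda>_. 1)"

lemma ones_mat_carrier [simp]: "ones_mat n \<in> carrier_mat n n"
  by (simp add: ones_mat_def)

lemma transpose_ones_mat: "transpose_mat (ones_mat n) = ones_mat n"
  by (intro eq_matI) (auto simp: ones_mat_def)

lemma ones_mat_mult_vec:
  "v \<in> carrier_vec n \<Longrightarrow> ones_mat n *\<^sub>v v = (ones n \<bullet> v) \<cdot>\<^sub>v ones n"
  by (intro eq_vecI) (auto simp: ones_mat_def scalar_prod_def)

lemma ones_scalar_ones: "ones n \<bullet> ones n = real n"
  by (simp add: scalar_prod_def)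

lemma H1_iff: "v \<in> H1 n \<longleftrightarrow> v \<in> carrier_vec n \<and> ones n \<bullet> v = 0"
  by (auto simp: H1_def scalar_prod_def atLeast0LessThan)

lemma H1_perp_iff: "v \<in> H1_perp n \<longleftrightarrow> (\<exists>c. v = c \<cdot>\<^sub>v ones n)"
  by (auto simp: H1_perp_def)

lemma H1_Int_H1_perp:
  assumes "v \<in> H1 n" "v \<in> H1_perp n"
  shows "v = 0\<^sub>v n"
proof -
  obtain c where v: "v = c \<cdot>\<^sub>v ones n" using assms(2) by (auto simp: H1_perp_iff)
  have "c * real n = 0" using assms(1) unfolding v H1_iff by (simp add: ones_scalar_ones)
  \<comment> \<open>For \<open>n = 0\<close> the scalar \<open>c\<close> may be nonzero, but the
    vectors are then empty.\<close>
  then show ?thesis unfolding v by (intro eq_vecI) auto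
qed

text \<open>What is kept of the Laplacian of a connected graph. The last clause concerns zeros of
  the quadratic form, which include the kernel of \<open>L\<close>.\<close>

definition psd_const_kernel :: "nat \<Rightarrow> real mat \<Rightarrow> bool" where
  "psd_const_kernel n L \<longleftrightarrow> L \<in> carrier_mat n n \<and> transpose_mat L = L \<and> L *\<^sub>v ones n = 0\<^sub>v n \<and>
     (\<forall>v\<in>carrier_vec n. v \<bullet> (L *\<^sub>v v) \<ge> 0 \<and> (v \<bullet> (L *\<^sub>v v) = 0 \<longrightarrow> v \<in> H1_perp n))"

lemma psd_const_kernelD:
  assumes "psd_const_kernel n L"
  shows "L \<in> carrier_mat n n" "transpose_mat L = L" "L *\<^sub>v ones n = 0\<^sub>v n"
    "v \<in> carrier_vec n \<Longrightarrow> v \<bullet> (L *\<^sub>v v) \<ge> 0"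
    "v \<in> carrier_vec n \<Longrightarrow> v \<bullet> (L *\<^sub>v v) = 0 \<Longrightarrow> v \<in> H1_perp n"
  using assms by (auto simp: psd_const_kernel_def)

text \<open>By symmetry, pairing \<open>L v\<close> with \<open>ones n\<close> equals pairing
  \<open>v\<close> with \<open>L\<close> applied to \<open>ones n\<close>, which is zero.\<close>

lemma psd_const_kernel_mult_in_H1:
  assumes "psd_const_kernel n L" "v \<in> carrier_vec n"
  shows "L *\<^sub>v v \<in> H1 n"
  using sym_form_commute[OF psd_const_kernelD(1,2)[OF assms(1)], of "ones n" v]
    psd_const_kernelD(1,3)[OF assms(1)] assms(2)
  by (auto simp: H1_iff)

lemma psd_const_kernel_mult_eq_0_iff:
  assumes L: "psd_const_kernel n L" and v: "v \<in> carrier_vec n"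
  shows "L *\<^sub>v v = 0\<^sub>v n \<longleftrightarrow> v \<in> H1_perp n"
proof
  show "L *\<^sub>v v = 0\<^sub>v n \<Longrightarrow> v \<in> H1_perp n" using psd_const_kernelD(5)[OF L v] v by simp
  show "v \<in> H1_perp n \<Longrightarrow> L *\<^sub>v v = 0\<^sub>v n"
    using psd_const_kernelD(1,3)[OF L] by (auto simp: H1_perp_iff mult_mat_vec[of L n n])
qed

lemma psd_const_kernel_smult:
  assumes "psd_const_kernel n L" "k > 0"
  shows "psd_const_kernel n (k \<cdot>\<^sub>m L)"
proof -
  note L = psd_const_kernelD[OF assms(1)]
  have "(k \<cdot>\<^sub>m L) *\<^sub>v v = k \<cdot>\<^sub>v (L *\<^sub>v v)" if "v \<in> carrier_vec n" for v
    using that L(1) by (intro eq_vecI) auto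
  then show ?thesis using assms(2) L
    unfolding psd_const_kernel_def by (auto simp: transpose_mat_smult)
qed

text \<open>The form is that of \<open>L\<close> plus the square of
  \<open>ones n \<bullet> v\<close>; where both vanish, \<open>v\<close> lies in
  \<open>H1_perp n\<close> and in \<open>H1 n\<close>.\<close>

lemma pos_def_mat_add_ones:
  assumes "psd_const_kernel n L"
  shows "pos_def_mat n (L + ones_mat n)"
  unfolding pos_def_mat_def
proof (intro conjI ballI impI)
  note L = psd_const_kernelD[OF assms]
  show "L + ones_mat n \<in> carrier_mat n n" using L(1) by simp
  show "transpose_mat (L + ones_mat n) = L + ones_mat n"
    using L(1,2) transpose_add[of L n n "ones_mat n"] by (simp add: transpose_ones_mat)
  fix v :: "real vec" assume v: "v \<in> carrier_vec n" "v \<noteq> 0\<^sub>v n"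
  have eq: "v \<bullet> ((L + ones_mat n) *\<^sub>v v) = v \<bullet> (L *\<^sub>v v) + (ones n \<bullet> v)\<^sup>2"
    using v L(1) by (simp add: add_mult_distrib_mat_vec[of _ n n] ones_mat_mult_vec
        scalar_prod_add_distrib[of _ n] comm_scalar_prod[of v n] power2_eq_square)
  have "v \<bullet> (L *\<^sub>v v) \<noteq> 0 \<or> ones n \<bullet> v \<noteq> 0"
    using L(5)[OF v(1)] H1_Int_H1_perp[of v n] v by (auto simp: H1_iff)
  then show "v \<bullet> ((L + ones_mat n) *\<^sub>v v) > 0"
    unfolding eq using L(4)[OF v(1)] by (smt (verit) zero_less_power2 zero_le_power2)
qed

lemma ones_mat_mult_psd_const_kernel:
  assumes "psd_const_kernel n L"
  shows "ones_mat n * L = 0\<^sub>m n n"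
proof -
  note L = psd_const_kernelD[OF assms]
  have "L * ones_mat n = 0\<^sub>m n n"
  proof (rule eq_matI)
    fix i j assume "i < dim_row (0\<^sub>m n n :: real mat)" "j < dim_col (0\<^sub>m n n :: real mat)"
    then have ij: "i < n" "j < n" by auto
    then have "col (ones_mat n) j = ones n" by (auto simp: ones_mat_def)
    then show "(L * ones_mat n) $$ (i, j) = 0\<^sub>m n n $$ (i, j)"
      using arg_cong[OF L(3), of "\<lambda>v. v $ i"] ij L(1) by (simp add: ones_mat_def)
  qed (use L(1) in \<open>auto simp: ones_mat_def\<close>)
  then show ?thesis
    using transpose_mult[OF L(1) ones_mat_carrier[of n]] L(2) by (simp add: transpose_ones_mat)
qed

section \<open>Quadratic form and connectedness of a weighted graph\<close>

text \<open>Loops are excluded because \<open>incidence_mat\<close> gives a loop a unit column instead of a zero one.\<close>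

definition proper_edges :: "nat \<Rightarrow> (nat \<times> nat) list \<Rightarrow> bool" where
  "proper_edges n es \<longleftrightarrow> (\<forall>(i, j)\<in>set es. i < n \<and> j < n \<and> i \<noteq> j)"

lemma incidence_mat_carrier: "incidence_mat n es \<in> carrier_mat n (length es)"
  by (simp add: incidence_mat_def)

lemma transpose_incidence_mult_vec:
  assumes es: "proper_edges n es" and v: "v \<in> carrier_vec n" and k: "k < length es"
  shows "(transpose_mat (incidence_mat n es) *\<^sub>v v) $ k = v $ snd (es ! k) - v $ fst (es ! k)"
proof -
  obtain i j where e: "es ! k = (i, j)" by (cases "es ! k")
  with es k have ij: "i < n" "j < n" "i \<noteq> j"
    using nth_mem[OF k] by (auto simp: proper_edges_def)
  have "(transpose_mat (incidence_mat n es) *\<^sub>v v) $ k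
      = (\<Sum>l = 0..<n. (if l = j then 1 else if l = i then - 1 else 0) * v $ l)"
    using k v by (simp add: incidence_mat_def scalar_prod_def e cong: if_cong)
  also have "\<dots> = (\<Sum>l = 0..<n. (if l = j then v $ l else 0) - (if l = i then v $ l else 0))"
    using ij by (intro sum.cong) auto
  also have "\<dots> = v $ j - v $ i" using ij by (simp add: sum_subtractf)
  finally show ?thesis by (simp add: e)
qed

lemma laplacian_form:
  assumes es: "proper_edges n es" and v: "v \<in> carrier_vec n"
  shows "v \<bullet> (laplacian n es w *\<^sub>v v)
    = (\<Sum>k<length es. w (fst (es ! k)) (snd (es ! k)) * (v $ snd (es ! k) - v $ fst (es ! k))\<^sup>2)"
proof -
  let ?B = "incidence_mat n es" and ?W = "weight_mat es w"
  let ?u = "transpose_mat ?B *\<^sub>v v"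
  have B: "?B \<in> carrier_mat n (length es)" and W: "?W \<in> carrier_mat (length es) (length es)"
    by (simp_all add: incidence_mat_carrier weight_mat_def)
  have u: "?u \<in> carrier_vec (length es)"
    by (rule mult_mat_vec_carrier[of _ _ n]) (use B v in auto)
  have "v \<bullet> (laplacian n es w *\<^sub>v v) = v \<bullet> (?B *\<^sub>v (?W *\<^sub>v ?u))"
    unfolding laplacian_def using B W v
    by (simp add: assoc_mult_mat_vec[of _ n "length es" _ n])
  also have "\<dots> = ?u \<bullet> (?W *\<^sub>v ?u)"
    using transpose_vec_mult_scalar[of ?B n "length es" "?W *\<^sub>v ?u" v] B W u v by simp
  also have "\<dots> = (\<Sum>k<length es. ?u $ k * (w (fst (es ! k)) (snd (es ! k)) * ?u $ k))"
  proof -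
    have "(?W *\<^sub>v ?u) $ k = w (fst (es ! k)) (snd (es ! k)) * ?u $ k" if "k < length es" for k
      unfolding weight_mat_def by (rule mat_diag_mult_vec[OF u that])
    then show ?thesis using u W by (simp add: scalar_prod_def atLeast0LessThan)
  qed
  finally show ?thesis
    by (simp add: transpose_incidence_mult_vec[OF es v] power2_eq_square ac_simps)
qed

text \<open>A zero of the form makes each nonnegative summand zero, so \<open>v\<close> agrees
  across edges and then along paths. Since \<open>conn\<close> uses the symmetric closure,
  \<open>es\<close> may list the arcs of a weakly connected digraph or one orientation of each
  undirected edge.\<close>

lemma psd_const_kernel_laplacian:
  assumes es: "proper_edges n es"
    and pos: "\<And>i j. (i, j) \<in> set es \<Longrightarrow> w i j > 0"
    and conn: "\<And>i j. i < n \<Longrightarrow> j < n \<Longrightarrow> (i, j) \<in> (set es \<union> (set es)\<inverse>)\<^sup>*"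
  shows "psd_const_kernel n (laplacian n es w)"
  unfolding psd_const_kernel_def
proof (intro conjI ballI impI)
  let ?B = "incidence_mat n es" and ?W = "weight_mat es w"
  have B: "?B \<in> carrier_mat n (length es)" and W: "?W \<in> carrier_mat (length es) (length es)"
    by (simp_all add: incidence_mat_carrier weight_mat_def)
  have Wt: "transpose_mat ?W = ?W" by (intro eq_matI) (auto simp: weight_mat_def mat_diag_def)
  show "laplacian n es w \<in> carrier_mat n n" using B W by (simp add: laplacian_def)
  have "transpose_mat (?B * ?W * transpose_mat ?B) = ?B * transpose_mat (?B * ?W)"
    using B W by (subst transpose_mult[of _ n "length es" _ n]) auto
  also have "transpose_mat (?B * ?W) = ?W * transpose_mat ?B"
    using transpose_mult[OF B W] Wt by simp
  finally show "transpose_mat (laplacian n es w) = laplacian n es w"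
    using B W by (simp add: laplacian_def)
  have "transpose_mat ?B *\<^sub>v ones n = 0\<^sub>v (length es)"
  proof (rule eq_vecI)
    fix k assume "k < dim_vec (0\<^sub>v (length es) :: real vec)"
    then have k: "k < length es" by simp
    then have "fst (es ! k) < n" "snd (es ! k) < n"
      using es nth_mem[OF k] by (auto simp: proper_edges_def case_prod_beta)
    then show "(transpose_mat ?B *\<^sub>v ones n) $ k = 0\<^sub>v (length es) $ k"
      using k by (simp add: transpose_incidence_mult_vec[OF es _ k])
  qed (use B in auto)
  then show "laplacian n es w *\<^sub>v ones n = 0\<^sub>v n"
    unfolding laplacian_def using B W
    by (simp add: assoc_mult_mat_vec[of _ n "length es" _ n] mult_mat_zero_vec[OF W] mult_mat_zero_vec[OF B])
  fix v :: "real vec" assume v: "v \<in> carrier_vec n"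
  have w: "w (fst (es ! k)) (snd (es ! k)) > 0" if "k < length es" for k
    using pos[of "fst (es ! k)" "snd (es ! k)"] nth_mem[OF that] by simp
  then have term_nonneg: "w (fst (es ! k)) (snd (es ! k)) * (v $ snd (es ! k) - v $ fst (es ! k))\<^sup>2 \<ge> 0"
    if "k < length es" for k using that by (simp add: less_imp_le)
  show "v \<bullet> (laplacian n es w *\<^sub>v v) \<ge> 0"
    unfolding laplacian_form[OF es v] by (rule sum_nonneg) (use term_nonneg in simp)
  assume "v \<bullet> (laplacian n es w *\<^sub>v v) = 0"
  then have zero: "v $ snd (es ! k) = v $ fst (es ! k)" if "k < length es" for k
    using that w[OF that] term_nonneg unfolding laplacian_form[OF es v]
    by (subst (asm) sum_nonneg_eq_0_iff) force+
  have edge: "v $ i = v $ j" if "(i, j) \<in> set es \<union> (set es)\<inverse>" for i j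
    using that zero by (auto simp: in_set_conv_nth) (metis fst_conv snd_conv)+
  have const: "v $ i = v $ j" if "i < n" "j < n" for i j
    using conn[OF that]
  proof (induction rule: rtrancl_induct)
    case (step y z)
    then show ?case using edge[OF step.hyps(2)] by simp
  qed simp
  \<comment> \<open>For \<open>n = 0\<close> the entry \<open>v $ 0\<close> is unspecified, but both
    vectors are empty.\<close>
  have "v = v $ 0 \<cdot>\<^sub>v ones n"
  proof (rule eq_vecI)
    fix i assume "i < dim_vec (v $ 0 \<cdot>\<^sub>v ones n)"
    then have i: "i < n" by simp
    then show "v $ i = (v $ 0 \<cdot>\<^sub>v ones n) $ i" using const[of i 0] by simp
  qed (use v in simp)
  then show "v \<in> H1_perp n" unfolding H1_perp_iff by blast
qed

lemma connected_with_proj_rtrancl: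
  assumes "connected (with_proj G)" "u \<in> pverts G" "v \<in> pverts G"
  shows "(u, v) \<in> (parcs G \<union> (parcs G)\<inverse>)\<^sup>*"
proof -
  have "symcl (parcs G) = parcs G \<union> (parcs G)\<inverse>" by (auto simp: symcl_def)
  moreover have "(u, v) \<in> rtrancl_on (pverts G) (symcl (parcs G))"
    using assms unfolding connected_conv by simp
  ultimately show ?thesis by (metis rtrancl_on_rtranclI)
qed

section \<open>The product \<open>L D M\<close>\<close>

text \<open>Graphs disappear here: two semidefinite matrices with constant kernel and a positive
  diagonal matrix remain. \<open>n > 0\<close> makes the constants a genuine line.\<close>

locale psd_product =
  fixes n :: nat and L M D Q :: "real mat" and d :: "nat \<Rightarrow> real"
  assumes n: "n > 0"
    and L: "psd_const_kernel n L" and M: "psd_const_kernel n M"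
    and d: "\<And>i. i < n \<Longrightarrow> d i > 0"
    and D: "D = mat_diag n d"
    and Q: "Q = L * D * M"
begin

lemmas Lc = psd_const_kernelD(1)[OF L] and Lt = psd_const_kernelD(2)[OF L]
lemmas Mc = psd_const_kernelD(1)[OF M] and Mt = psd_const_kernelD(2)[OF M]

lemma Dc: "D \<in> carrier_mat n n"
  by (simp add: D)

lemma Dt: "transpose_mat D = D"
  unfolding D by (intro eq_matI) (auto simp: mat_diag_def)

lemma Qc: "Q \<in> carrier_mat n n"
  using Lc Mc Dc by (simp add: Q)

lemma Q_mult_vec: "v \<in> carrier_vec n \<Longrightarrow> Q *\<^sub>v v = L *\<^sub>v (D *\<^sub>v (M *\<^sub>v v))"
  unfolding Q using Lc Mc Dc by (simp add: assoc_mult_mat_vec[of _ n n _ n] del: assoc_mult_mat)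

lemma Q_in_H1: "v \<in> carrier_vec n \<Longrightarrow> Q *\<^sub>v v \<in> H1 n"
  unfolding Q_mult_vec using psd_const_kernel_mult_in_H1[OF L] Dc Mc by auto

section \<open>Kernel, range and invertibility on \<open>H1\<close>\<close>

lemma form_D_pos:
  assumes "v \<in> carrier_vec n" "v \<noteq> 0\<^sub>v n"
  shows "v \<bullet> (D *\<^sub>v v) > 0"
proof -
  obtain i where i: "i < n" "v $ i \<noteq> 0" using assms by (metis carrier_vecD eq_vecI index_zero_vec)
  have "dim_vec (D *\<^sub>v v) = n" using Dc by auto
  then have "v \<bullet> (D *\<^sub>v v) = (\<Sum>i = 0..<n. v $ i * (D *\<^sub>v v) $ i)"
    by (simp only: scalar_prod_def)
  also have "\<dots> = (\<Sum>i = 0..<n. v $ i * (d i * v $ i))"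
    using assms(1) by (intro sum.cong refl) (simp only: D mat_diag_mult_vec atLeastLessThan_iff)
  also have "\<dots> = (\<Sum>i = 0..<n. d i * (v $ i)\<^sup>2)" by (simp add: power2_eq_square ac_simps)
  also have "\<dots> > 0"
    by (rule sum_pos2[of _ i]) (use i d in \<open>auto simp: less_imp_le\<close>)
  finally show ?thesis .
qed

lemma Q_mult_eq_0_iff:
  assumes v: "v \<in> carrier_vec n"
  shows "Q *\<^sub>v v = 0\<^sub>v n \<longleftrightarrow> v \<in> H1_perp n"
proof
  assume "v \<in> H1_perp n"
  then have "M *\<^sub>v v = 0\<^sub>v n" using psd_const_kernel_mult_eq_0_iff[OF M v] by blast
  then show "Q *\<^sub>v v = 0\<^sub>v n"
    using v Lc Dc by (simp add: Q_mult_vec mult_mat_zero_vec[of _ n n])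
next
  assume "Q *\<^sub>v v = 0\<^sub>v n"
  then have "D *\<^sub>v (M *\<^sub>v v) \<in> H1_perp n"
    using psd_const_kernel_mult_eq_0_iff[OF L, of "D *\<^sub>v (M *\<^sub>v v)"] v Mc Dc
    by (simp add: Q_mult_vec)
  then obtain c where c: "D *\<^sub>v (M *\<^sub>v v) = c \<cdot>\<^sub>v ones n" by (auto simp: H1_perp_iff)
  have "M *\<^sub>v v \<in> H1 n" by (rule psd_const_kernel_mult_in_H1[OF M v])
  then have Mv: "M *\<^sub>v v \<in> carrier_vec n" "ones n \<bullet> (M *\<^sub>v v) = 0" by (auto simp: H1_iff)
  \<comment> \<open>\<open>M v\<close> lies in \<open>H1 n\<close>, hence is orthogonal to every
    constant vector.\<close>
  have "(M *\<^sub>v v) \<bullet> (D *\<^sub>v (M *\<^sub>v v)) = 0"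
    unfolding c using Mv by (simp add: comm_scalar_prod[of "M *\<^sub>v v" n])
  then have "M *\<^sub>v v = 0\<^sub>v n" using form_D_pos[OF Mv(1)] by fastforce
  then show "v \<in> H1_perp n" using psd_const_kernel_mult_eq_0_iff[OF M v] by blast
qed

lemma kernel_Q: "mat_kernel Q = H1_perp n"
  unfolding mat_kernel[OF Qc]
proof -
  have "H1_perp n \<subseteq> carrier_vec n" by (auto simp: H1_perp_def)
  then show "{v. v \<in> carrier_vec n \<and> Q *\<^sub>v v = 0\<^sub>v n} = H1_perp n"
    using Q_mult_eq_0_iff by blast
qed

text \<open>\<open>Q\<close> is onto \<open>H\<^sup>1\<close> because \<open>Q\<close> plus the all-ones matrix is invertible and preserves the
  decomposition into \<open>H\<^sup>1\<close> and its complement.\<close>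

lemma Q_surj_H1:
  assumes u: "u \<in> H1 n"
  obtains v where "v \<in> H1 n" "Q *\<^sub>v v = u"
proof -
  have split: "(Q + ones_mat n) *\<^sub>v v = Q *\<^sub>v v + (ones n \<bullet> v) \<cdot>\<^sub>v ones n"
    if "v \<in> carrier_vec n" for v
    using that Qc by (simp add: add_mult_distrib_mat_vec[of _ n n] ones_mat_mult_vec)
  have H1: "v \<in> H1 n \<and> Q *\<^sub>v v = w"
    if v: "v \<in> carrier_vec n" and w: "w \<in> H1 n" and eq: "(Q + ones_mat n) *\<^sub>v v = w" for v w
  proof -
    \<comment> \<open>Both \<open>w\<close> and \<open>Q v\<close> are orthogonal to
      \<open>ones n\<close>, so pairing with it isolates the constant component.\<close>
    have "0 = ones n \<bullet> (Q *\<^sub>v v + (ones n \<bullet> v) \<cdot>\<^sub>v ones n)"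
      using w unfolding eq[symmetric] split[OF v] by (simp add: H1_iff)
    also have "\<dots> = (ones n \<bullet> v) * real n"
      using Q_in_H1[OF v] v Qc
      by (subst scalar_prod_add_distrib[of _ n]) (auto simp: H1_iff ones_scalar_ones)
    finally have "ones n \<bullet> v = 0" using n by simp
    moreover from this have "Q *\<^sub>v v = w" using eq Qc v w unfolding split[OF v] by (auto simp: H1_iff)
    ultimately show ?thesis using v by (simp add: H1_iff)
  qed
  have QJ: "Q + ones_mat n \<in> carrier_mat n n" using Qc by simp
  obtain B where B: "B \<in> carrier_mat n n" "(Q + ones_mat n) * B = 1\<^sub>m n"
  proof (rule injective_mat_inverse[OF QJ])
    fix v assume v: "v \<in> carrier_vec n" "(Q + ones_mat n) *\<^sub>v v = 0\<^sub>v n"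
    then have "v \<in> H1 n \<and> Q *\<^sub>v v = 0\<^sub>v n" by (intro H1) (auto simp: H1_iff)
    then show "v = 0\<^sub>v n" using Q_mult_eq_0_iff[OF v(1)] H1_Int_H1_perp by blast
  qed
  have uc: "u \<in> carrier_vec n" using u by (simp add: H1_iff)
  have "(Q + ones_mat n) *\<^sub>v (B *\<^sub>v u) = u"
    using assoc_mult_mat_vec[OF QJ B(1) uc] B(2) uc by simp
  then show ?thesis using H1[of "B *\<^sub>v u" u] B(1) u uc that by auto
qed

lemma range_Q: "mat_range Q = H1 n"
proof
  show "mat_range Q \<subseteq> H1 n" using Q_in_H1 Qc by (auto simp: mat_range_def)
  show "H1 n \<subseteq> mat_range Q"
  proof
    fix u assume "u \<in> H1 n"
    then obtain v where "v \<in> H1 n" "Q *\<^sub>v v = u" by (rule Q_surj_H1)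
    then show "u \<in> mat_range Q" using Qc by (auto simp: mat_range_def H1_iff)
  qed
qed

text \<open>The difference of two vectors of \<open>H1 n\<close> with equal image lies in
  \<open>H1 n\<close> and in the kernel \<open>H1_perp n\<close>.\<close>

lemma bij_betw_Q: "bij_betw (\<lambda>v. Q *\<^sub>v v) (H1 n) (H1 n)"
  unfolding bij_betw_def
proof
  show "inj_on (\<lambda>v. Q *\<^sub>v v) (H1 n)"
  proof (rule inj_onI)
    fix u v assume uv: "u \<in> H1 n" "v \<in> H1 n" "Q *\<^sub>v u = Q *\<^sub>v v"
    then have c: "u \<in> carrier_vec n" "v \<in> carrier_vec n" by (auto simp: H1_iff)
    have "Q *\<^sub>v (u - v) = 0\<^sub>v n" using c uv(3) Qc by (simp add: mult_minus_distrib_mat_vec[OF Qc])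
    then have "u - v \<in> H1_perp n" using Q_mult_eq_0_iff[of "u - v"] c by simp
    moreover have "u - v \<in> H1 n"
      using uv c by (auto simp: H1_iff scalar_prod_minus_distrib[of _ n])
    ultimately have diff: "u - v = 0\<^sub>v n" by (rule H1_Int_H1_perp[rotated])
    have "u $ i = v $ i" if "i < n" for i
      using arg_cong[OF diff, of "\<lambda>v. v $ i"] that c by simp
    then show "u = v" using c by auto
  qed
  show "(\<lambda>v. Q *\<^sub>v v) ` H1 n = H1 n"
  proof
    show "(\<lambda>v. Q *\<^sub>v v) ` H1 n \<subseteq> H1 n" using Q_in_H1 by (auto simp: H1_iff)
    show "H1 n \<subseteq> (\<lambda>v. Q *\<^sub>v v) ` H1 n" using Q_surj_H1 by (metis image_eqI subsetI)
  qed
qed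

text \<open>The common end of both cases, with \<open>C\<close> left open. An eigenvalue times a
  positive squared \<open>C\<close>-norm is a value of the nonnegative form; the multiplicity of
  zero is the dimension of the kernel, the line of constants.\<close>

lemma spectral_properties:
  assumes C: "pos_def_mat n C" and sym: "transpose_mat (C * Q) = C * Q"
    and nonneg: "\<And>v. v \<in> carrier_vec n \<Longrightarrow> v \<bullet> (C *\<^sub>v (Q *\<^sub>v v)) \<ge> 0"
  shows "diagonalizable Q" "real_nonneg_eigenvalues Q" "algebraic_multiplicity Q 0 = 1"
proof -
  show "diagonalizable Q" by (rule selfadjoint_diagonalizable[OF C Qc sym])
  have "e \<ge> 0" if "eigenvalue Q e" for e
  proof -
    from that obtain v where v: "v \<in> carrier_vec n" "v \<noteq> 0\<^sub>v n" "Q *\<^sub>v v = e \<cdot>\<^sub>v v"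
      using Qc by (auto simp: eigenvalue_def eigenvector_def)
    have "e * (v \<bullet> (C *\<^sub>v v)) \<ge> 0"
      using nonneg[OF v(1)] v pos_def_matD(1)[OF C] by (simp add: mult_mat_vec[of C n n])
    then show ?thesis using pos_def_matD(3)[OF C v(1,2)] by (simp add: zero_le_mult_iff)
  qed
  then show "real_nonneg_eigenvalues Q"
    using selfadjoint_eigenvalue_real[OF C Qc sym] by (auto simp: real_nonneg_eigenvalues_def)
  have "char_matrix Q 0 = Q" using Qc by (intro eq_matI) (auto simp: char_matrix_def)
  moreover have "kernel_dim Q = 1"
  proof (rule kernel_dim_line[OF Qc])
    show "ones n \<noteq> 0\<^sub>v n" using n by (metis index_vec index_zero_vec(1) zero_neq_one)
  qed (simp add: kernel_Q H1_perp_def)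
  ultimately show "algebraic_multiplicity Q 0 = 1"
    by (simp add: algebraic_multiplicity_def selfadjoint_order_char_poly[OF C Qc sym])
qed

text \<open>For \<open>D = I\<close>, \<open>Q\<close> is self-adjoint for the inner product given by \<open>M\<close> plus the all-ones
  matrix: its Gram form is \<open>M * L * M\<close>, since the all-ones matrix annihilates \<open>L\<close>.\<close>

lemma spectral_properties_one:
  assumes D1: "D = 1\<^sub>m n"
  shows "diagonalizable Q" "real_nonneg_eigenvalues Q" "algebraic_multiplicity Q 0 = 1"
proof -
  let ?C = "M + ones_mat n"
  have C: "pos_def_mat n ?C" by (rule pos_def_mat_add_ones[OF M])
  have QLM: "Q = L * M" using Q Lc Mc D1 by simp
  have "?C * Q = M * (L * M) + ones_mat n * (L * M)"
    unfolding QLM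
    by (rule add_mult_distrib_mat[OF Mc ones_mat_carrier mult_carrier_mat[OF Lc Mc]])
  also have "ones_mat n * (L * M) = (ones_mat n * L) * M"
    using Lc Mc by (simp add: assoc_mult_mat[of _ n n _ n _ n])
  also have "\<dots> = 0\<^sub>m n n" using Mc by (simp add: ones_mat_mult_psd_const_kernel[OF L])
  finally have CQ: "?C * Q = M * (L * M)" using Lc Mc by simp
  have sym: "transpose_mat (?C * Q) = ?C * Q"
    unfolding CQ using Lc Mc Lt Mt by (simp add: transpose_mult[of _ n n _ n])
  have nonneg: "v \<bullet> (?C *\<^sub>v (Q *\<^sub>v v)) \<ge> 0" if v: "v \<in> carrier_vec n" for v
  proof -
    have "v \<bullet> (?C *\<^sub>v (Q *\<^sub>v v)) = v \<bullet> ((?C * Q) *\<^sub>v v)"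
      using assoc_mult_mat_vec[OF pos_def_matD(1)[OF C] Qc v] by simp
    also have "\<dots> = v \<bullet> (M *\<^sub>v (L *\<^sub>v (M *\<^sub>v v)))"
      unfolding CQ using Lc Mc v
      by (simp add: assoc_mult_mat_vec[of _ n n _ n] del: assoc_mult_mat)
    also have "\<dots> = (M *\<^sub>v v) \<bullet> (L *\<^sub>v (M *\<^sub>v v))"
      using transpose_vec_mult_scalar[of M n n "L *\<^sub>v (M *\<^sub>v v)" v] Mt Lc Mc v by simp
    also have "\<dots> \<ge> 0" by (rule psd_const_kernelD(4)[OF L]) (use Mc v in auto)
    finally show ?thesis .
  qed
  show "diagonalizable Q" "real_nonneg_eigenvalues Q" "algebraic_multiplicity Q 0 = 1"
    using spectral_properties[OF C sym nonneg] by auto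
qed

text \<open>If \<open>L D M = M D L\<close>, then \<open>Q\<close> is symmetric. Positivity follows Wigner's argument: relative
  to \<open>C\<close>, which is \<open>M\<close> plus the all-ones matrix, every generalized eigenvector \<open>Q x = e C x\<close> with
  \<open>e \<noteq> 0\<close> has \<open>L D y = e y\<close> for \<open>y = M x\<close>, so \<open>e\<close> is a quotient of values of the forms \<open>L\<close> and \<open>D\<close>.\<close>

lemma form_Q_nonneg:
  assumes Qt: "transpose_mat Q = Q" and v: "v \<in> carrier_vec n"
  shows "v \<bullet> (Q *\<^sub>v v) \<ge> 0"
proof -
  let ?C = "M + ones_mat n"
  have C: "pos_def_mat n ?C" by (rule pos_def_mat_add_ones[OF M])
  note Cc = pos_def_matD(1)[OF C]
  obtain B where B: "B \<in> carrier_mat n n" "?C * B = 1\<^sub>m n"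
  proof (rule injective_mat_inverse[OF Cc])
    fix v assume "v \<in> carrier_vec n" "?C *\<^sub>v v = 0\<^sub>v n"
    then show "v = 0\<^sub>v n" using pos_def_matD(5)[OF C, of v] by simp
  qed
  \<comment> \<open>\<open>K\<close> is \<open>Q\<close> multiplied by the inverse of
    \<open>?C\<close>, so the generalized eigenvectors become eigenvectors of \<open>K\<close>,
    which is self-adjoint for \<open>?C\<close> because \<open>?C * K = Q\<close> is
    symmetric.\<close>
  define K where "K = B * Q"
  have K: "K \<in> carrier_mat n n" using B Qc by (simp add: K_def)
  have CK: "?C * K = Q"
    unfolding K_def using assoc_mult_mat[OF Cc B(1) Qc] B(2) Qc by simp
  have ev: "e \<ge> 0" if "eigenvalue K e" for e
  proof (rule ccontr)
    assume e: "\<not> e \<ge> 0"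
    from that obtain x where x: "x \<in> carrier_vec n" "x \<noteq> 0\<^sub>v n" "K *\<^sub>v x = e \<cdot>\<^sub>v x"
      using K by (auto simp: eigenvalue_def eigenvector_def)
    have "Q *\<^sub>v x = ?C *\<^sub>v (K *\<^sub>v x)" using assoc_mult_mat_vec[OF Cc K x(1)] CK by simp
    also have "\<dots> = e \<cdot>\<^sub>v (M *\<^sub>v x + (ones n \<bullet> x) \<cdot>\<^sub>v ones n)"
      unfolding x(3) mult_mat_vec[OF Cc x(1)] using x(1) Mc
      by (simp add: add_mult_distrib_mat_vec[of _ n n] ones_mat_mult_vec)
    finally have Qx: "Q *\<^sub>v x = e \<cdot>\<^sub>v (M *\<^sub>v x + (ones n \<bullet> x) \<cdot>\<^sub>v ones n)" .
    have Mx: "M *\<^sub>v x \<in> carrier_vec n" "ones n \<bullet> (M *\<^sub>v x) = 0"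
      using psd_const_kernel_mult_in_H1[OF M x(1)] by (auto simp: H1_iff)
    \<comment> \<open>Pair the equation \<open>Qx\<close> with \<open>ones n\<close>: both
      \<open>Q x\<close> and \<open>M x\<close> lie in \<open>H1 n\<close>, so only the constant
      term survives.\<close>
    have "0 = e * ((ones n \<bullet> x) * real n)"
      using Q_in_H1[OF x(1)] Mx x(1) unfolding Qx H1_iff
      by (simp add: scalar_prod_add_distrib[of _ n] ones_scalar_ones)
    then have ox: "ones n \<bullet> x = 0" using e n by simp
    let ?y = "M *\<^sub>v x"
    have Dy: "D *\<^sub>v ?y \<in> carrier_vec n" using Dc Mx by simp
    have LDy: "L *\<^sub>v (D *\<^sub>v ?y) = e \<cdot>\<^sub>v ?y"
    proof -
      have "y + 0 \<cdot>\<^sub>v ones n = y" if "y \<in> carrier_vec n" for y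
        using that by (intro eq_vecI) auto
      from this[OF Mx(1)] show ?thesis using Qx unfolding Q_mult_vec[OF x(1)] ox by simp
    qed
    \<comment> \<open>\<open>x\<close> is a nonzero vector of \<open>H1 n\<close>, which meets the
      kernel of \<open>M\<close> only in zero.\<close>
    have "?y \<noteq> 0\<^sub>v n"
      using psd_const_kernel_mult_eq_0_iff[OF M x(1)] H1_Int_H1_perp[of x n] x ox
      by (auto simp: H1_iff)
    then have "?y \<bullet> (D *\<^sub>v ?y) > 0" using form_D_pos Mx by blast
    \<comment> \<open>Pairing \<open>LDy\<close> with \<open>D y\<close> equates a negative number
      with a value of the semidefinite form of \<open>L\<close>.\<close>
    moreover have "e * (?y \<bullet> (D *\<^sub>v ?y)) = (D *\<^sub>v ?y) \<bullet> (L *\<^sub>v (D *\<^sub>v ?y))"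
      unfolding LDy using Mx Dy by (simp add: comm_scalar_prod[of "?y" n])
    ultimately show False
      using psd_const_kernelD(4)[OF L Dy] e mult_neg_pos[of e "?y \<bullet> (D *\<^sub>v ?y)"] by linarith
  qed
  have "v \<bullet> (?C *\<^sub>v (K *\<^sub>v v)) \<ge> 0"
    by (rule selfadjoint_form_nonneg[OF C K _ ev v]) (simp_all add: CK Qt)
  then show ?thesis using assoc_mult_mat_vec[OF Cc K v] CK by simp
qed

text \<open>Transposition reverses the three symmetric factors, so \<open>comm\<close> says that
  \<open>Q\<close> is symmetric and the standard inner product applies.\<close>

lemma spectral_properties_commute:
  assumes comm: "L * D * M = M * D * L"
  shows "diagonalizable Q" "real_nonneg_eigenvalues Q" "algebraic_multiplicity Q 0 = 1"
proof -
  have "transpose_mat Q = M * (D * L)"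
    unfolding Q using Lc Mc Dc Lt Mt Dt by (simp add: transpose_mult[of _ n n _ n])
  then have Qt: "transpose_mat Q = Q"
    unfolding Q comm using Lc Mc Dc by simp
  have 1: "transpose_mat (1\<^sub>m n * Q) = 1\<^sub>m n * Q" using Qt Qc by simp
  have 2: "v \<bullet> (1\<^sub>m n *\<^sub>v (Q *\<^sub>v v)) \<ge> 0" if "v \<in> carrier_vec n" for v
    using form_Q_nonneg[OF Qt that] Qc that by simp
  show "diagonalizable Q" "real_nonneg_eigenvalues Q" "algebraic_multiplicity Q 0 = 1"
    using spectral_properties[OF pos_def_mat_one 1 2] by auto
qed

end

theorem proposition3:
  fixes N :: nat
    and Gc Gel :: "nat pair_pre_digraph"
    and a w :: "nat \<Rightarrow> nat \<Rightarrow> real"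
    and ec eel :: "(nat \<times> nat) list"
    and kI :: real
    and d :: "nat \<Rightarrow> real"
    and \<L> \<M> D Q :: "real mat"
  assumes Gc: "pair_graph Gc" "pverts Gc = {0..<N}" "connected (with_proj Gc)"
    and a_sym: "\<And>i j. (i, j) \<in> parcs Gc \<Longrightarrow> a i j = a j i"
    and a_pos: "\<And>i j. (i, j) \<in> parcs Gc \<Longrightarrow> a i j > 0"
    and ec: "orientation Gc ec"
    and kI: "kI > 0"
    and L: "\<L> = kI \<cdot>\<^sub>m laplacian N ec a"
    and Gel: "pair_digraph Gel" "pverts Gel = {0..<N}" "connected (with_proj Gel)"
    and w_pos: "\<And>i j. (i, j) \<in> parcs Gel \<Longrightarrow> w i j > 0"
    and eel: "arc_list Gel eel"
    and M: "\<M> = laplacian N eel w"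
    and d_pos: "\<And>i. i < N \<Longrightarrow> d i > 0"
    and D: "D = mat_diag N d"
    and Q: "Q = \<L> * D * \<M>"
  shows "mat_kernel Q = H1_perp N
    \<and> mat_range Q = H1 N
    \<and> bij_betw (\<lambda>v. Q *\<^sub>v v) (H1 N) (H1 N)
    \<and> (D = 1\<^sub>m N \<or> D \<noteq> 1\<^sub>m N \<and> \<L> * D * \<M> = \<M> * D * \<L> \<longrightarrow>
          diagonalizable Q \<and> real_nonneg_eigenvalues Q)
    \<and> (D = 1\<^sub>m N \<or> D \<noteq> 1\<^sub>m N \<and> \<L> * D * \<M> = \<M> * D * \<L> \<longrightarrow>
          algebraic_multiplicity Q 0 = 1)"
proof -
  \<comment> \<open>Connectedness includes that the vertex set is nonempty.\<close>
  have pos: "N > 0"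
    using Gc(2,3) unfolding connected_conv by simp
  interpret Gc: pair_graph Gc by (rule Gc(1))
  interpret Gel: pair_digraph Gel by (rule Gel(1))
  have conn: "(i, j) \<in> (parcs G \<union> (parcs G)\<inverse>)\<^sup>*"
    if "pverts G = {0..<N}" "connected (with_proj G)" "i < N" "j < N" for G i j
    using connected_with_proj_rtrancl[OF that(2)] that by simp
  have ec_set: "set ec \<union> (set ec)\<inverse> = parcs Gc" using ec by (simp add: orientation_def)
  \<comment> \<open>An orientation together with its converse is already symmetric, so symmetrizing
    the arcs of \<open>Gc\<close> again adds nothing.\<close>
  have "(set ec \<union> (set ec)\<inverse>) \<union> (set ec \<union> (set ec)\<inverse>)\<inverse> = set ec \<union> (set ec)\<inverse>" by auto
  then have conn_ec: "(i, j) \<in> (set ec \<union> (set ec)\<inverse>)\<^sup>*" if "i < N" "j < N" for i j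
    using conn[OF Gc(2,3) that] by (simp add: ec_set)
  have "proper_edges N ec"
    using Gc.arc_fst_in_verts Gc.arc_snd_in_verts Gc.pair_no_loops Gc(2) ec_set
    unfolding proper_edges_def by fastforce
  then have "psd_const_kernel N (laplacian N ec a)"
    using a_pos ec_set conn_ec by (intro psd_const_kernel_laplacian) auto
  then have "psd_const_kernel N \<L>" unfolding L using kI by (rule psd_const_kernel_smult)
  moreover have "psd_const_kernel N \<M>"
  proof -
    have eel_set: "set eel = parcs Gel" using eel by (simp add: arc_list_def)
    have "proper_edges N eel"
      using Gel.arc_fst_in_verts Gel.arc_snd_in_verts Gel.pair_no_loops Gel(2) eel_set
      unfolding proper_edges_def by fastforce
    then show ?thesis unfolding M
      using w_pos eel_set conn[OF Gel(2,3)] by (intro psd_const_kernel_laplacian) auto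
  qed
  ultimately interpret psd_product N \<L> \<M> D Q d
    using pos d_pos D Q by unfold_locales auto
  show ?thesis
    using kernel_Q range_Q bij_betw_Q spectral_properties_one spectral_properties_commute by blast
qed

end
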